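(* Let $E^1,E^2\subset\mathbb{R}^2$ be two distinct lines through the origin with irrational slopes, and let $(P,L,I)$ be a T-configuration for $(E^1,E^2)$, with associated points $A,B$ (the endpoints of $I$). Let $C$ be the next, after $B$, point of intersection of $p(L)$ with $I$ along $p(L)$. Then the arc $PC$ of $p(L)$ and the arc $I$ divide $\mathbb{T}^2$ into two Markov parallelograms for the directions $E^1,E^2$, i.e. they define a two-element quasi-Markov partition: $\mathbb{T}^2\setminus(PC\cup I)=P_1^\circ\sqcup P_2^\circ$ for two Markov parallelograms $P_1,P_2$.
   Context: $\mathbb{T}^2=\mathbb{R}^2/\mathbb{Z}^2$, $p:\mathbb{R}^2\to\mathbb{T}^2$ is the projection. Fix two distinct lines $E^1,E^2$ through the origin of $\mathbb{R}^2$ with irrational slopes. A Markov parallelogram in the plane (for the directions $E^1,E^2$) is a closed parallelogram $\Pi$ with two sides parallel to $E^1$ and two sides parallel to $E^2$. A Markov parallelogram in the torus is $P=p(\Pi)$ for such a $\Pi$ provided $p$ is injective on $\mathrm{int}\,\Pi$; one writes $P^\circ=p(\mathrm{int}\,\Pi)$. A quasi-Markov partition (qMp) is a finite system $\{P_1,\ldots,P_k\}$ of Markov parallelograms in the torus such that the $P_i^\circ$ are pairwise disjoint and $\mathbb{T}^2\setminus(P_1^\circ\cup\ldots\cup P_k^\circ)$ is a finite union of arcs lying on projections of lines parallel to $E^1$ or $E^2$. A T-configuration consists of the following data. A point $P=p(Q)\in\mathbb{T}^2$; a choice of one of the lines $E^1+Q,E^2+Q$, say $E^1+Q$ (the other choice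 is treated in the same way with the roles of $E^1,E^2$ exchanged); a ray $L$ of the other line $E^2+Q$ beginning at $Q$; and an arc $I$ of $p(E^1+Q)$ passing through $P$ (with $P$ in its interior) with endpoints $A,B$ such that, denoting by $z(t)$, $t\ge 0$, the point of $L$ at distance $t$ from $Q$, one has $A=p(z(t_A))$, $B=p(z(t_B))$ with $0<t_A<t_B$ and $p(z(t))\notin I$ for $0<t<t_B$, $t\ne t_A$. The point $C$ is $p(z(t_C))$, where $t_C>t_B$ is the smallest $t>t_B$ with $p(z(t))\in I$, and the arc $PC$ is $\{p(z(t)):0\le t\le t_C\}$. *)

theory Defs
  imports "HOL-Analysis.Analysis"
begin

type_synonym plane = "real \<times> real"

definition lattice_rel :: "(plane \<times> plane) set" where
  "lattice_rel = {(x, y). y - x \<in> \<int> \<times> \<int>}"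

definition torus :: "plane set set" where
  "torus = UNIV // lattice_rel"

definition torus_proj :: "plane \<Rightarrow> plane set" where
  "torus_proj x = lattice_rel `` {x}"

definition irrational_line :: "plane set \<Rightarrow> bool" where
  "irrational_line E \<longleftrightarrow> (\<exists>\<alpha>. \<alpha> \<notin> \<rat> \<and> E = {(s, \<alpha> * s) | s. True})"

definition markov_parallelogram :: "plane set \<Rightarrow> plane set \<Rightarrow> plane set \<Rightarrow> bool" where
  "markov_parallelogram E1 E2 R \<longleftrightarrow>
     (\<exists>x u v. u \<in> E1 \<and> u \<noteq> 0 \<and> v \<in> E2 \<and> v \<noteq> 0 \<and>
        R = convex hull {x, x + u, x + u + v, x + v})"

(* A Markov parallelogram P in the torus is represented by a planar lift R, because its
   open part is by definition torus_proj ` interior R; P itself is torus_proj ` R. *)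
definition torus_markov_parallelogram :: "plane set \<Rightarrow> plane set \<Rightarrow> plane set \<Rightarrow> bool" where
  "torus_markov_parallelogram E1 E2 R \<longleftrightarrow>
     markov_parallelogram E1 E2 R \<and> inj_on torus_proj (interior R)"

definition open_part :: "plane set \<Rightarrow> plane set set" where
  "open_part R = torus_proj ` interior R"

(* A nondegenerate closed arc on the projection of some line parallel to E. For irrational E,
   torus_proj is injective on such a line, so the arcs are the images of the segments. *)
definition leaf_arc :: "plane set \<Rightarrow> plane set set \<Rightarrow> bool" where
  "leaf_arc E X \<longleftrightarrow>
     (\<exists>x y. x \<noteq> y \<and> y - x \<in> E \<and> X = torus_proj ` closed_segment x y)"

(* The system is P_1, ..., P_k with P_i = torus_proj ` R i. *)
definition quasi_Markov_partition ::
  "plane set \<Rightarrow> plane set \<Rightarrow> nat \<Rightarrow> (nat \<Rightarrow> plane set) \<Rightarrow> bool" where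
  "quasi_Markov_partition E1 E2 k R \<longleftrightarrow>
     (\<forall>i\<in>{1..k}. torus_markov_parallelogram E1 E2 (R i)) \<and>
     (\<forall>i\<in>{1..k}. \<forall>j\<in>{1..k}. i \<noteq> j \<longrightarrow> open_part (R i) \<inter> open_part (R j) = {}) \<and>
     (\<exists>\<A>. finite \<A> \<and> (\<forall>X\<in>\<A>. leaf_arc E1 X \<or> leaf_arc E2 X) \<and>
        torus - (\<Union>i\<in>{1..k}. open_part (R i)) = \<Union>\<A>)"

(* A ray beginning at Q is given by its unit direction vector v; for norm v = 1 this is the
   point of the ray at distance t from Q. *)
definition ray_point :: "plane \<Rightarrow> plane \<Rightarrow> real \<Rightarrow> plane" where
  "ray_point Q v t = Q + t *\<^sub>R v"

(* (E, F) is the choice of which of the two lines through Q carries the arc I (direction E)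
   and which carries the ray (direction F). The segment from a to b is the lift of I to
   Q + E, and a, b are the lifts of the endpoints A, B. *)
definition T_configuration ::
  "plane set \<Rightarrow> plane set \<Rightarrow> plane \<Rightarrow> plane \<Rightarrow> plane set set \<Rightarrow> plane set \<Rightarrow> plane set
     \<Rightarrow> real \<Rightarrow> real \<Rightarrow> bool" where
  "T_configuration E1 E2 Q v I A B tA tB \<longleftrightarrow>
     (\<exists>E F a b. ((E = E1 \<and> F = E2) \<or> (E = E2 \<and> F = E1)) \<and>
        v \<in> F \<and> norm v = 1 \<and>
        a - Q \<in> E \<and> b - Q \<in> E \<and> Q \<in> open_segment a b \<and>
        I = torus_proj ` closed_segment a b \<and> A = torus_proj a \<and> B = torus_proj b \<and>
        0 < tA \<and> tA < tB \<and>
        A = torus_proj (ray_point Q v tA) \<and> B = torus_proj (ray_point Q v tB) \<and>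
        (\<forall>t. 0 < t \<and> t < tB \<and> t \<noteq> tA \<longrightarrow> torus_proj (ray_point Q v t) \<notin> I))"

definition next_hit :: "plane \<Rightarrow> plane \<Rightarrow> plane set set \<Rightarrow> real \<Rightarrow> real \<Rightarrow> bool" where
  "next_hit Q v I tB tC \<longleftrightarrow>
     tB < tC \<and> torus_proj (ray_point Q v tC) \<in> I \<and>
     (\<forall>t. tB < t \<and> t < tC \<longrightarrow> torus_proj (ray_point Q v t) \<notin> I)"

definition ray_arc :: "plane \<Rightarrow> plane \<Rightarrow> real \<Rightarrow> plane set set" where
  "ray_arc Q v tC = (\<lambda>t. torus_proj (ray_point Q v t)) ` {0..tC}"

end

(* Use affine coordinates with origin Q in which I lies on the x-axis as [-a, b] and the ray is
   the positive y-axis, and let G be the lattice of integer vectors in these coordinates. The two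
   hits of the endpoints put (a, s) and (-b, t) into G (s = tA, t = tB), and the absence of other
   hits before t says that the triangle with vertices 0, (a, s), (-b, t) contains no further
   lattice point, so these two vectors form a basis of G. Hence the boxes [-a, 0) x [0, t) and
   [0, b) x [0, s) together are a fundamental domain, the next hit is (a - b, s + t), and the sides
   of the boxes are lattice translates of subsets of I and of the ray up to height s + t. *)
theory Submission
  imports Defs
begin

section \<open>The lattice in affine coordinates: basis and next return\<close>

locale return_lattice =
  fixes a b s t :: real and G :: "plane set"
  assumes pos: "0 < a" "0 < b" "0 < s" "s < t"
    and add: "\<And>w w'. w \<in> G \<Longrightarrow> w' \<in> G \<Longrightarrow> w + w' \<in> G"
    and neg: "\<And>w. w \<in> G \<Longrightarrow> - w \<in> G"
    and gen: "(a, s) \<in> G" "(- b, t) \<in> G"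
    and axis: "\<And>x. (x, 0) \<in> G \<Longrightarrow> x = 0"
    \<comment> \<open>A lattice point (x, y) in the strip means that the ray meets I at height y,
      in the point (- x, 0).\<close>
    and return: "\<And>x y. (x, y) \<in> G \<Longrightarrow> - b \<le> x \<Longrightarrow> x \<le> a \<Longrightarrow> 0 < y \<Longrightarrow> y < t \<Longrightarrow> y = s"
begin

lemma diff: "w \<in> G \<Longrightarrow> w' \<in> G \<Longrightarrow> w - w' \<in> G"
  using add[of w "- w'"] neg[of w'] by simp

lemma zero: "(0, 0) \<in> G"
  using diff[OF gen(1) gen(1)] by (simp add: zero_prod_def)

lemma multiple: "w \<in> G \<Longrightarrow> of_int n *\<^sub>R w \<in> G"
proof (induction n rule: int_induct[where k = 0])
  case base
  then show ?case using zero by (simp add: zero_prod_def)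
next
  case (step1 i)
  then show ?case using add[of "of_int i *\<^sub>R w" w] by (simp add: scaleR_add_left)
next
  case (step2 i)
  then show ?case using diff[of "of_int i *\<^sub>R w" w] by (simp add: scaleR_diff_left)
qed

lemma combination: "(of_int m * a - of_int n * b, of_int m * s + of_int n * t) \<in> G"
  using add[OF multiple[OF gen(1), of m] multiple[OF gen(2), of n]] by simp

text \<open>A nonzero point of this kind lies in the open strip between \<open>- b\<close> and
  \<open>a\<close> at a height strictly between 0 and \<open>t\<close>, so \<open>return\<close>
  puts it at height \<open>s\<close>. Subtracting \<open>(a, s)\<close> leaves a horizontal lattice
  vector, which vanishes by \<open>axis\<close>; this would force the first coordinate to be
  \<open>a\<close>.\<close>

lemma empty_triangle:
  assumes "0 \<le> \<sigma>" "\<sigma> < 1" "0 \<le> \<tau>" "\<tau> < 1" "\<sigma> + \<tau> \<le> 1"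
    and mem: "(\<sigma> * a - \<tau> * b, \<sigma> * s + \<tau> * t) \<in> G"
  shows "\<sigma> = 0 \<and> \<tau> = 0"
proof (rule ccontr)
  assume ne: "\<not> (\<sigma> = 0 \<and> \<tau> = 0)"
  have t0: "0 < t" using pos by simp
  have sa: "0 \<le> \<sigma> * a" "\<sigma> * a < a" and tb: "0 \<le> \<tau> * b" "\<tau> * b < b"
    using assms pos by simp_all
  have "0 \<le> \<sigma> * s" "0 \<le> \<tau> * t" using assms pos t0 by auto
  moreover have "0 < \<sigma> * s \<or> 0 < \<tau> * t" using assms ne pos t0 by auto
  ultimately have h0: "0 < \<sigma> * s + \<tau> * t" by linarith
  \<comment> \<open>Strictness comes from \<open>\<tau> < 1\<close> when
    \<open>\<sigma> = 0\<close>, and from \<open>s < t\<close> otherwise.\<close>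
  have h1: "\<sigma> * s + \<tau> * t < t"
  proof (cases "\<sigma> = 0")
    case True
    then show ?thesis using assms t0 by simp
  next
    case False
    then have "\<sigma> * s < \<sigma> * t" using assms pos by simp
    moreover have "(\<sigma> + \<tau>) * t \<le> 1 * t"
      using assms t0 by (intro mult_right_mono) auto
    ultimately show ?thesis by (simp add: algebra_simps)
  qed
  have "\<sigma> * s + \<tau> * t = s"
    using return[OF mem] sa tb h0 h1 by simp
  then have "(\<sigma> * a - \<tau> * b - a, 0) \<in> G"
    using diff[OF mem gen(1)] by simp
  then have "\<sigma> * a - \<tau> * b = a" using axis by fastforce
  then show False using sa tb by linarith
qed

text \<open>Removing integer parts leaves a lattice point in the half-open parallelogram spanned by
  the two generators. The diagonal \<sigma>' + \<tau>' = 1 cuts it into the empty triangle and a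
  second triangle, which the half-turn sending each point to \<open>(a, s) + (- b, t)\<close> minus
  that point carries into the first.\<close>

lemma basis:
  assumes "w \<in> G"
  obtains m n :: int where "w = (m * a - n * b, m * s + n * t)"
proof -
  obtain x y where w: "w = (x, y)" by fastforce
  \<comment> \<open>Cramer's rule: \<open>d\<close> is the determinant of \<open>(a, s)\<close> and
    \<open>(- b, t)\<close>.\<close>
  define d where "d = a * t + b * s"
  have t0: "0 < t" using pos by simp
  have d0: "0 < d" unfolding d_def using pos t0 by (simp add: add_pos_pos)
  define \<sigma> \<tau> where "\<sigma> = (x * t + y * b) / d" and "\<tau> = (a * y - s * x) / d"
  have x: "x = \<sigma> * a - \<tau> * b" and y: "y = \<sigma> * s + \<tau> * t"
    unfolding \<sigma>_def \<tau>_def using d0 by (simp_all add: field_simps) (simp_all add: d_def algebra_simps)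
  define \<sigma>' \<tau>' where "\<sigma>' = frac \<sigma>" and "\<tau>' = frac \<tau>"
  have r: "0 \<le> \<sigma>'" "\<sigma>' < 1" "0 \<le> \<tau>'" "\<tau>' < 1"
    unfolding \<sigma>'_def \<tau>'_def by (auto simp: frac_lt_1)
  have mem: "(\<sigma>' * a - \<tau>' * b, \<sigma>' * s + \<tau>' * t) \<in> G"
    using diff[OF assms combination[of "\<lfloor>\<sigma>\<rfloor>" "\<lfloor>\<tau>\<rfloor>"]]
    by (simp add: w x y \<sigma>'_def \<tau>'_def frac_def algebra_simps)
  have "\<sigma>' = 0 \<and> \<tau>' = 0"
  proof (cases "\<sigma>' + \<tau>' \<le> 1")
    case True
    then show ?thesis using empty_triangle r mem by blast
  next
    case False
    have "((1 - \<sigma>') * a - (1 - \<tau>') * b, (1 - \<sigma>') * s + (1 - \<tau>') * t) \<in> G"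
      using diff[OF add[OF gen] mem] by (simp add: algebra_simps)
    then show ?thesis using empty_triangle[of "1 - \<sigma>'" "1 - \<tau>'"] r False by simp
  qed
  then have "\<sigma> = of_int \<lfloor>\<sigma>\<rfloor>" "\<tau> = of_int \<lfloor>\<tau>\<rfloor>"
    unfolding \<sigma>'_def \<tau>'_def by (simp_all add: frac_def)
  then show thesis using that w x y by metis
qed

text \<open>The generators point to opposite sides of the vertical axis. If one coefficient is
  nonpositive, positive height makes the other at least 1, and both generators then push the same
  way horizontally; the strip has room for only one generator.\<close>

lemma nonneg_combination_cases:
  fixes m n :: int
  assumes "- b \<le> m * a - n * b" "m * a - n * b \<le> a" "0 < m * s + n * t"
  shows "m = 1 \<and> n = 0 \<or> m = 0 \<and> n = 1 \<or> 1 \<le> m \<and> 1 \<le> n"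
proof -
  have t0: "0 < t" using pos by simp
  consider "1 \<le> m" "1 \<le> n" | "n \<le> 0" | "m \<le> 0" "1 \<le> n" by linarith
  then show ?thesis
  proof cases
    case 2
    then have n: "real_of_int n * b \<le> 0" "real_of_int n * t \<le> 0"
      using pos t0 by (simp_all add: mult_le_0_iff)
    then have "0 < m * s" using assms by linarith
    then have m: "1 \<le> m" using pos by (simp add: zero_less_mult_iff)
    have "m * a \<le> 1 * a" using n assms by linarith
    then have "real_of_int m \<le> 1" using pos mult_le_cancel_right_pos by blast
    then have "m = 1" using m by simp
    moreover from this have "0 \<le> n * b" using assms by simp
    then have "0 \<le> n" using pos by (simp add: zero_le_mult_iff)
    ultimately show ?thesis using 2 by simp
  next
    case 3
    then have m: "real_of_int m * a \<le> 0" using pos by (simp add: mult_le_0_iff)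
    have "n * b \<le> 1 * b" using m assms by linarith
    then have "real_of_int n \<le> 1" using pos mult_le_cancel_right_pos by blast
    then have "n = 1" using 3 by simp
    moreover from this have "0 \<le> m * a" using assms by simp
    then have "0 \<le> m" using pos by (simp add: zero_le_mult_iff)
    ultimately show ?thesis using 3 by simp
  qed simp
qed

text \<open>Above height \<open>t\<close> the generators themselves are excluded, so both
  coefficients are at least 1 and the height is at least \<open>s + t\<close>. The sum of the
  generators lies in the strip and attains this bound.\<close>

lemma next_return:
  assumes "t < h" "(x, h) \<in> G" "- b \<le> x" "x \<le> a"
    and first: "\<And>y x. t < y \<Longrightarrow> y < h \<Longrightarrow> - b \<le> x \<Longrightarrow> x \<le> a \<Longrightarrow> (x, y) \<notin> G"
  shows "h = s + t"
proof -
  obtain m n :: int where mn: "x = m * a - n * b" "h = m * s + n * t"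
    using basis[OF assms(2)] by (metis prod.inject)
  have t0: "0 < t" using pos by simp
  have "m = 1 \<and> n = 0 \<or> m = 0 \<and> n = 1 \<or> 1 \<le> m \<and> 1 \<le> n"
    using nonneg_combination_cases[of m n] assms mn t0 by simp
  then have "1 \<le> m" "1 \<le> n" using assms mn pos by auto
  then have "1 * s \<le> m * s" "1 * t \<le> n * t" using pos t0 by simp_all
  then have "s + t \<le> h" using mn by simp
  moreover have "(a - b, s + t) \<in> G" using add[OF gen] by simp
  then have "\<not> s + t < h" using first[of "s + t" "a - b"] pos by auto
  ultimately show ?thesis by simp
qed

section \<open>The fundamental domain: two half-open return towers over one base interval\<close>

definition tile :: "plane set" where
  "tile = {- a..<0} \<times> {0..<t} \<union> {0..<b} \<times> {0..<s}"

text \<open>Going down the first-return flow: subtract (a, s) on the right, (- b, t) on the left.\<close>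

lemma tile_covers_aux:
  assumes "0 \<le> y" "- a \<le> x" "x < b" "y \<le> real N * s"
  shows "\<exists>w \<in> G. (x, y) + w \<in> tile"
  using assms
proof (induction N arbitrary: x y)
  case 0
  then show ?case using zero pos by (intro bexI[of _ "(0, 0)"]) (auto simp: tile_def)
next
  case (Suc N)
  \<comment> \<open>Outside the tile the point lies above one of the boxes. Either subtraction keeps
    it over the base and lowers it by at least \<open>s\<close>, since \<open>s < t\<close>; thus
    \<open>N\<close> bounds the number of rounds.\<close>
  consider (inside) "(x, y) \<in> tile" | (right) "0 \<le> x" "s \<le> y" | (left) "x < 0" "t \<le> y"
    using Suc.prems by (force simp: tile_def)
  then show ?case
  proof cases
    case inside
    then show ?thesis using zero by (intro bexI[of _ "(0, 0)"]) auto
  next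
    case right
    obtain w where "w \<in> G" "(x - a, y - s) + w \<in> tile"
      using Suc.IH[of "y - s" "x - a"] Suc.prems right pos by (auto simp: algebra_simps)
    then show ?thesis using diff[OF _ gen(1), of w]
      by (intro bexI[of _ "w - (a, s)"]) (auto simp: prod_eq_iff plus_prod_def minus_prod_def algebra_simps)
  next
    case left
    obtain w where "w \<in> G" "(x + b, y - t) + w \<in> tile"
      using Suc.IH[of "y - t" "x + b"] Suc.prems left pos by (auto simp: algebra_simps)
    then show ?thesis using diff[OF _ gen(2), of w]
      by (intro bexI[of _ "w - (- b, t)"]) (auto simp: prod_eq_iff plus_prod_def minus_prod_def algebra_simps)
  qed
qed

text \<open>Any point is first brought above the base. Adding \<open>(a, s)\<close> often enough
  makes both coordinates nonnegative; then the right number \<open>n\<close> of copies of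
  \<open>(- b, t)\<close> moves the first coordinate into \<open>[0, b)\<close>, and as
  \<open>n\<close> is nonnegative the height only grows.\<close>

lemma tile_covers: "\<exists>w \<in> G. z + w \<in> tile"
proof -
  obtain x y where z: "z = (x, y)" by fastforce
  have t0: "0 < t" using pos by simp
  obtain m1 :: nat where m1: "\<bar>x\<bar> < m1 * a" using pos ex_less_of_nat_mult by blast
  obtain m2 :: nat where m2: "\<bar>y\<bar> < m2 * s" using pos ex_less_of_nat_mult by blast
  define m where "m = m1 + m2"
  define n where "n = \<lfloor>(x + m * a) / b\<rfloor>"
  have xm: "0 \<le> x + m * a" and ym: "0 \<le> y + m * s"
    using m1 m2 pos by (auto simp: m_def algebra_simps) (smt (verit) mult_nonneg_nonneg of_nat_0_le_iff)+
  have "0 \<le> n" unfolding n_def using xm pos by simp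
  then have nt: "0 \<le> n * t" using t0 by simp
  have "of_int n \<le> (x + m * a) / b" "(x + m * a) / b < of_int n + 1"
    unfolding n_def by linarith+
  then have n: "n * b \<le> x + m * a" "x + m * a < n * b + b"
    using pos by (simp_all add: field_simps)
  define x' y' where "x' = x + (m * a - n * b)" and "y' = y + (m * s + n * t)"
  obtain N :: nat where "y' < N * s" using pos ex_less_of_nat_mult by blast
  then obtain w where w: "w \<in> G" "(x', y') + w \<in> tile"
    using tile_covers_aux[of y' x' N] n nt ym pos by (auto simp: x'_def y'_def)
  have "(m * a - n * b, m * s + n * t) + w \<in> G"
    using add[OF combination[of "int m" n] w(1)] by simp
  moreover have "z + ((m * a - n * b, m * s + n * t) + w) \<in> tile"
    using w(2) by (simp add: z x'_def y'_def add.assoc[symmetric])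
  ultimately show ?thesis by blast
qed

text \<open>The tile has width \<open>a + b\<close> and height \<open>t\<close>, which rules out
  every nonzero translation except positive multiples of \<open>(a, s)\<close>. Those would land
  over \<open>[0, b)\<close> at height at least \<open>s\<close>, above the right box.\<close>

lemma tile_unique_upward:
  fixes m n :: int
  assumes "(x, y) \<in> tile" "(x + (m * a - n * b), y + (m * s + n * t)) \<in> tile" "0 \<le> m"
  shows "m = 0 \<and> n = 0"
proof -
  have t0: "0 < t" using pos by simp
  have bounds: "- a \<le> x" "x < b" "0 \<le> y" "y < t"
    "- a \<le> x + (m * a - n * b)" "x + (m * a - n * b) < b"
    "0 \<le> y + (m * s + n * t)" "y + (m * s + n * t) < t"
    using assms pos by (auto simp: tile_def)
  have low: "x < 0 \<or> y < s" "x + (m * a - n * b) < 0 \<or> y + (m * s + n * t) < s"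
    using assms by (auto simp: tile_def)
  consider "1 \<le> m" "1 \<le> n" | "1 \<le> m" "n \<le> -1" | "1 \<le> m" "n = 0"
    | "m = 0" "1 \<le> n" | "m = 0" "n \<le> -1" | "m = 0" "n = 0"
    using assms(3) by linarith
  then show ?thesis
  proof cases
    case 1
    then have "1 * s \<le> m * s" "1 * t \<le> n * t" using pos t0 by simp_all
    then show ?thesis using bounds pos by linarith
  next
    case 2
    then have "1 * a \<le> m * a" using pos by simp
    moreover have "n * b \<le> (-1) * b" using 2 pos by (intro mult_right_mono) auto
    ultimately show ?thesis using bounds pos by linarith
  next
    case 3
    then have "1 * a \<le> m * a" "1 * s \<le> m * s" "n * b = 0" "n * t = 0" using pos by simp_all
    then show ?thesis using low bounds by argo
  next
    case 4
    then have "1 * b \<le> n * b" "1 * t \<le> n * t" "m * a = 0" "m * s = 0" using pos t0 by simp_all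
    then show ?thesis using low bounds by argo
  next
    case 5
    then have n: "real_of_int n \<le> -1" by linarith
    have "n * b \<le> (-1) * b" "n * t \<le> (-1) * t"
      using mult_right_mono[OF n, of b] mult_right_mono[OF n, of t] pos t0 by simp_all
    moreover have "m * a = 0" "m * s = 0" using 5 by simp_all
    ultimately show ?thesis using low bounds by argo
  qed simp
qed

lemma tile_unique:
  assumes "z \<in> tile" "z' \<in> tile" "z' - z \<in> G"
  shows "z' = z"
proof -
  obtain x y x' y' where z: "z = (x, y)" "z' = (x', y')" by fastforce
  obtain m n :: int where mn: "z' - z = (m * a - n * b, m * s + n * t)"
    using basis[OF assms(3)] .
  then have e: "x' = x + (m * a - n * b)" "y' = y + (m * s + n * t)" using z by auto
  have "m = 0 \<and> n = 0"
  proof (cases "0 \<le> m")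
    case True
    then show ?thesis using tile_unique_upward[of x y m n] assms z e by simp
  next
    case False
    then show ?thesis using tile_unique_upward[of x' y' "- m" "- n"] assms z e by simp
  qed
  then show ?thesis using z e by simp
qed

section \<open>The lifted arcs and the open boxes, modulo the lattice\<close>

definition walls :: "plane set" where
  "walls = {0} \<times> {0..s + t} \<union> {- a..b} \<times> {0}"

definition left_cell :: "plane set" where "left_cell = {- a<..<0} \<times> {0<..<t}"

definition right_cell :: "plane set" where "right_cell = {0<..<b} \<times> {0<..<s}"

lemma cells_subset_tile: "left_cell \<subseteq> tile" "right_cell \<subseteq> tile"
  by (auto simp: left_cell_def right_cell_def tile_def)

lemma cells_disjoint: "left_cell \<inter> right_cell = {}"
  by (auto simp: left_cell_def right_cell_def)

text \<open>The half-open tile contains no top sides. Its bottom and the side at 0 are walls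
  already, and the side at \<open>- a\<close> is carried by \<open>(a, s)\<close> onto the upper
  part of the ray.\<close>

lemma tile_diff_cells_wall:
  assumes "z \<in> tile" "z \<notin> left_cell \<union> right_cell"
  shows "\<exists>w \<in> G. z + w \<in> walls"
proof -
  obtain x y where z: "z = (x, y)" by fastforce
  consider "y = 0" "x \<in> {- a..b}" | "x = 0" "y \<in> {0..s + t}" | "x = - a" "y + s \<in> {0..s + t}"
    using assms z pos by (force simp: tile_def left_cell_def right_cell_def)
  then show ?thesis
  proof cases
    case 3
    then show ?thesis using gen(1) by (intro bexI[of _ "(a, s)"]) (auto simp: z walls_def)
  qed (auto simp: z walls_def intro!: bexI[OF _ zero])
qed

lemma wall_in_tile:
  assumes "z \<in> walls"
  shows "\<exists>w \<in> G. z + w \<in> tile - (left_cell \<union> right_cell)"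
proof -
  obtain x y where z: "z = (x, y)" by fastforce
  consider "y = 0" "- a \<le> x" "x < b" | "y = 0" "x = b" | "x = 0" "0 \<le> y" "y < s"
    | "x = 0" "s \<le> y" "y < s + t" | "x = 0" "y = s + t"
    using assms z by (force simp: walls_def)
  then show ?thesis
  proof cases
    case 1
    then show ?thesis using pos
      by (intro bexI[OF _ zero]) (auto simp: z tile_def left_cell_def right_cell_def)
  next
    \<comment> \<open>The right end of the base is outside the tile; this translation moves it to
      \<open>(- a, t - s)\<close> on the left side of the left box.\<close>
    case 2
    then show ?thesis using diff[OF gen(2,1)] pos
      by (intro bexI[of _ "(- b, t) - (a, s)"]) (auto simp: z tile_def left_cell_def right_cell_def)
  next
    case 3
    then show ?thesis using pos
      by (intro bexI[OF _ zero]) (auto simp: z tile_def left_cell_def right_cell_def)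
  next
    case 4
    then show ?thesis using neg[OF gen(1)] pos
      by (intro bexI[of _ "- (a, s)"]) (auto simp: z tile_def left_cell_def right_cell_def)
  next
    \<comment> \<open>The end of the ray returns to the base, at the point
      \<open>(b - a, 0)\<close>.\<close>
    case 5
    then show ?thesis using neg[OF add[OF gen]] pos
      by (intro bexI[of _ "- ((a, s) + (- b, t))"]) (auto simp: z tile_def left_cell_def right_cell_def)
  qed
qed

text \<open>A wall point has a representative in the tile outside the cells. A cell point in the
  same class is a tile point too, so uniqueness of representatives would make the two equal.\<close>

lemma wall_not_cell:
  assumes "z \<in> walls" "z' \<in> left_cell \<union> right_cell"
  shows "z' - z \<notin> G"
proof
  assume g: "z' - z \<in> G"
  obtain w where w: "w \<in> G" "z + w \<in> tile - (left_cell \<union> right_cell)"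
    using wall_in_tile[OF assms(1)] by blast
  have "z' - (z + w) \<in> G" using diff[OF g w(1)] by (simp add: algebra_simps)
  then have "z' = z + w" using tile_unique[of "z + w" z'] w assms cells_subset_tile by blast
  then show False using w assms by blast
qed

lemma cell_or_wall: "\<exists>w \<in> G. z + w \<in> walls \<union> left_cell \<union> right_cell"
proof -
  obtain w where w: "w \<in> G" "z + w \<in> tile" using tile_covers by blast
  show ?thesis
  proof (cases "z + w \<in> left_cell \<union> right_cell")
    case False
    then obtain w' where "w' \<in> G" "z + w + w' \<in> walls" using tile_diff_cells_wall w by blast
    then show ?thesis using add[OF w(1), of w'] by (auto simp: add.assoc)
  qed (use w in blast)
qed

end

section \<open>Torus classes and symmetry in the two directions\<close>

lemma torus_proj_eq_iff: "torus_proj x = torus_proj y \<longleftrightarrow> y - x \<in> \<int> \<times> \<int>"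
proof -
  have "equiv UNIV lattice_rel"
  proof (rule equivI)
    show "refl lattice_rel" by (auto simp: refl_on_def lattice_rel_def zero_prod_def)
    show "sym lattice_rel"
      by (auto simp: sym_def lattice_rel_def) (metis Ints_minus minus_diff_eq)+
    show "trans lattice_rel"
      by (auto simp: trans_def lattice_rel_def) (metis Ints_add diff_add_cancel add_diff_eq)+
  qed auto
  then show ?thesis
    unfolding torus_proj_def by (subst eq_equiv_class_iff) (auto simp: lattice_rel_def)
qed

lemma torus_eq_range: "torus = range torus_proj"
  by (auto simp: torus_def quotient_def torus_proj_def)

text \<open>Going round the same parallelogram in the opposite sense exchanges the two edge
  vectors.\<close>

lemma markov_parallelogram_swap: "markov_parallelogram E F = markov_parallelogram F E"
proof -
  have "markov_parallelogram F E R" if "markov_parallelogram E F R" for E F R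
  proof -
    from that obtain x u v where h: "u \<in> E" "u \<noteq> 0" "v \<in> F" "v \<noteq> 0"
      "R = convex hull {x, x + u, x + u + v, x + v}"
      unfolding markov_parallelogram_def by blast
    have "{x, x + u, x + u + v, x + v} = {x, x + v, x + v + u, x + u}"
      by (auto simp: algebra_simps)
    then show ?thesis using h unfolding markov_parallelogram_def by metis
  qed
  then show ?thesis by blast
qed

lemma quasi_Markov_partition_swap:
  "quasi_Markov_partition E F k R = quasi_Markov_partition F E k R"
  unfolding quasi_Markov_partition_def torus_markov_parallelogram_def
  by (simp only: markov_parallelogram_swap[of E F] disj_commute)

section \<open>Affine charts of the plane\<close>

definition chart :: "plane \<Rightarrow> plane \<Rightarrow> plane \<Rightarrow> plane \<Rightarrow> plane" where
  "chart Q e f z = Q + (fst z *\<^sub>R e + snd z *\<^sub>R f)"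

lemma chart_diff: "chart Q e f z' - chart Q e f z = fst (z' - z) *\<^sub>R e + snd (z' - z) *\<^sub>R f"
  by (simp add: chart_def algebra_simps)

lemma linear_chart: "linear (\<lambda>z :: plane. fst z *\<^sub>R (e :: plane) + snd z *\<^sub>R f)"
  by (rule linearI) (simp_all add: algebra_simps)

text \<open>Separates the linear part from the translation, so that facts about hulls, interiors and
  surjectivity of linear maps carry over to charts.\<close>

lemma chart_image: "chart Q e f ` S = (+) Q ` (\<lambda>z. fst z *\<^sub>R e + snd z *\<^sub>R f) ` S"
  by (simp add: image_image chart_def)

lemma convex_hull_chart: "convex hull (chart Q e f ` S) = chart Q e f ` (convex hull S)"
  by (simp add: chart_image convex_hull_translation convex_hull_linear_image[OF linear_chart])

lemma interior_chart:
  assumes "inj (chart Q e f)"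
  shows "interior (chart Q e f ` S) = chart Q e f ` interior S"
proof -
  have "inj (\<lambda>z. fst z *\<^sub>R e + snd z *\<^sub>R f)"
    using assms by (simp add: inj_def chart_def)
  then show ?thesis
    by (simp add: chart_image interior_translation interior_injective_linear_image[OF linear_chart])
qed

lemma inj_chart:
  assumes "fst e * snd f \<noteq> snd e * fst f"
  shows "inj (chart Q e f)"
proof (rule injI)
  fix z z' assume eq: "chart Q e f z = chart Q e f z'"
  define x y where "x = fst z - fst z'" and "y = snd z - snd z'"
  have "chart Q e f z - chart Q e f z' = 0" using eq by simp
  then have c: "x * fst e + y * fst f = 0" "x * snd e + y * snd f = 0"
    unfolding chart_diff by (simp_all add: prod_eq_iff x_def y_def)
  \<comment> \<open>Cramer's rule again: the determinant times each coordinate is a combination of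
    the two vanishing expressions in \<open>c\<close>.\<close>
  have "x * (fst e * snd f - snd e * fst f)
      = (x * fst e + y * fst f) * snd f - (x * snd e + y * snd f) * fst f"
    "y * (fst e * snd f - snd e * fst f)
      = (x * snd e + y * snd f) * fst e - (x * fst e + y * fst f) * snd e"
    by (simp_all add: algebra_simps)
  then have "x = 0" "y = 0" using c assms by auto
  then show "z = z'" by (simp add: x_def y_def prod_eq_iff)
qed

lemma surj_chart:
  assumes "inj (chart Q e f)"
  shows "surj (chart Q e f)"
proof -
  have "inj (\<lambda>z. fst z *\<^sub>R e + snd z *\<^sub>R f)"
    using assms by (simp add: inj_def chart_def)
  then have "surj (\<lambda>z. fst z *\<^sub>R e + snd z *\<^sub>R f)"
    using linear_injective_imp_surjective[OF linear_chart] by blast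
  then show ?thesis unfolding chart_image[of Q e f UNIV] by simp
qed

lemma chart_horizontal_segment:
  assumes "x \<le> x'"
  shows "closed_segment (chart Q e f (x, y)) (chart Q e f (x', y)) = chart Q e f ` ({x..x'} \<times> {y})"
proof -
  have "{x..x'} \<times> {y} = convex hull ({x, x'} \<times> {y})"
    using assms by (simp only: convex_hull_Times segment_convex_hull[symmetric])
      (simp add: closed_segment_eq_real_ivl)
  then show ?thesis by (simp add: convex_hull_chart[symmetric] segment_convex_hull)
qed

lemma chart_vertical_segment:
  assumes "y \<le> y'"
  shows "closed_segment (chart Q e f (x, y)) (chart Q e f (x, y')) = chart Q e f ` ({x} \<times> {y..y'})"
proof -
  have "{x} \<times> {y..y'} = convex hull ({x} \<times> {y, y'})"
    using assms by (simp only: convex_hull_Times segment_convex_hull[symmetric])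
      (simp add: closed_segment_eq_real_ivl)
  then show ?thesis by (simp add: convex_hull_chart[symmetric] segment_convex_hull)
qed

lemma markov_parallelogram_chart:
  assumes "\<And>c. c *\<^sub>R e \<in> E" "e \<noteq> 0" "\<And>c. c *\<^sub>R f \<in> F" "f \<noteq> 0" and x: "x < x'" and y: "y < y'"
  shows "markov_parallelogram E F (chart Q e f ` ({x..x'} \<times> {y..y'}))"
proof -
  let ?p = "chart Q e f (x, y)" and ?u = "(x' - x) *\<^sub>R e" and ?v = "(y' - y) *\<^sub>R f"
  have "{x..x'} \<times> {y..y'} = convex hull ({x, x'} \<times> {y, y'})"
    using x y by (simp only: convex_hull_Times segment_convex_hull[symmetric])
      (simp add: closed_segment_eq_real_ivl)
  moreover have "{x, x'} \<times> {y, y'} = {(x, y), (x', y), (x', y'), (x, y')}" by auto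
  then have "chart Q e f ` ({x, x'} \<times> {y, y'}) = {?p, ?p + ?u, ?p + ?u + ?v, ?p + ?v}"
    by (simp add: chart_def algebra_simps)
  ultimately have "chart Q e f ` ({x..x'} \<times> {y..y'}) = convex hull {?p, ?p + ?u, ?p + ?u + ?v, ?p + ?v}"
    by (simp add: convex_hull_chart[symmetric])
  moreover have "?u \<noteq> 0" "?v \<noteq> 0" using assms by auto
  ultimately show ?thesis unfolding markov_parallelogram_def using assms by blast
qed

section \<open>Lines of irrational slope\<close>

lemma irrational_line_scale: "irrational_line E \<Longrightarrow> w \<in> E \<Longrightarrow> c *\<^sub>R w \<in> E"
  unfolding irrational_line_def by (auto simp: algebra_simps)

text \<open>A nonzero integer point would exhibit the slope as a quotient of two integers. This is
  the source of the locale assumption \<open>axis\<close>.\<close>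

lemma irrational_line_integer_point:
  assumes "irrational_line E" "w \<in> E" "w \<in> \<int> \<times> \<int>"
  shows "w = 0"
proof -
  obtain \<alpha> r where w: "\<alpha> \<notin> \<rat>" "w = (r, \<alpha> * r)"
    using assms unfolding irrational_line_def by auto
  have "r = 0"
  proof (rule ccontr)
    assume "r \<noteq> 0"
    then have "\<alpha> = (\<alpha> * r) / r" by simp
    moreover have "\<alpha> * r \<in> \<rat>" "r \<in> \<rat>" using assms(3) w Ints_subset_Rats by auto
    ultimately show False using w(1) Rats_divide by metis
  qed
  then show ?thesis using w by (simp add: zero_prod_def)
qed

text \<open>For \<open>e = (r, \<alpha> * r)\<close> and \<open>f = (r', \<beta> * r')\<close> the
  determinant is \<open>r * r' * (\<beta> - \<alpha>)\<close>.\<close>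

lemma irrational_lines_independent:
  assumes "irrational_line E" "irrational_line F" "E \<noteq> F" "e \<in> E" "e \<noteq> 0" "f \<in> F" "f \<noteq> 0"
  shows "fst e * snd f \<noteq> snd e * fst f"
proof -
  obtain \<alpha> \<beta> where "E = {(s, \<alpha> * s) | s. True}" "F = {(s, \<beta> * s) | s. True}"
    using assms unfolding irrational_line_def by blast
  moreover from this obtain r r' where "e = (r, \<alpha> * r)" "f = (r', \<beta> * r')" using assms by auto
  ultimately show ?thesis using assms by (auto simp: zero_prod_def)
qed

section \<open>From the T-configuration to the partition\<close>

lemma T_configuration_partition:
  assumes E: "irrational_line E" and F: "irrational_line F" and "E \<noteq> F"
    and v: "v \<in> F" "norm v = 1" and a: "a - Q \<in> E" and Q: "Q \<in> open_segment a b"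
    and I: "I = torus_proj ` closed_segment a b"
    and tAB: "0 < tA" "tA < tB"
    and A: "torus_proj a = torus_proj (ray_point Q v tA)"
    and B: "torus_proj b = torus_proj (ray_point Q v tB)"
    and avoid: "\<And>t. 0 < t \<Longrightarrow> t < tB \<Longrightarrow> t \<noteq> tA \<Longrightarrow> torus_proj (ray_point Q v t) \<notin> I"
    and hit: "next_hit Q v I tB tC"
  shows "\<exists>R. quasi_Markov_partition E F 2 R \<and>
           torus - (ray_arc Q v tC \<union> I) = open_part (R 1) \<union> open_part (R 2) \<and>
           open_part (R 1) \<inter> open_part (R 2) = {}"
proof -
  \<comment> \<open>With this choice of scale and sign the lattice parameter a is 1.\<close>
  define e where "e = Q - a"
  have eE: "e \<in> E" using irrational_line_scale[OF E a, of "-1"] by (simp add: e_def)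
  have e0: "e \<noteq> 0" using Q by (auto simp: e_def open_segment_def)
  have v0: "v \<noteq> 0" using v by auto
  obtain u where u: "0 < u" "u < 1" "Q = (1 - u) *\<^sub>R a + u *\<^sub>R b"
    using Q by (auto simp: in_segment)
  \<comment> \<open>\<open>Q\<close> divides the segment from \<open>a\<close> to \<open>b\<close>
    in the ratio \<open>u : 1 - u\<close>, so \<open>\<beta>\<close> is the length of the second
    piece measured in units of \<open>e\<close>.\<close>
  define \<beta> where "\<beta> = (1 - u) / u"
  have \<beta>0: "0 < \<beta>" using u by (simp add: \<beta>_def)
  have "u *\<^sub>R (b - Q) = (1 - u) *\<^sub>R e" using u(3) by (simp add: e_def algebra_simps)
  then have "inverse u *\<^sub>R (u *\<^sub>R (b - Q)) = inverse u *\<^sub>R ((1 - u) *\<^sub>R e)" by simp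
  then have bQ: "b - Q = \<beta> *\<^sub>R e" using u by (simp add: \<beta>_def divide_inverse mult.commute)

  let ?\<phi> = "chart Q e v"
  have inj: "inj ?\<phi>"
    using inj_chart irrational_lines_independent[OF E F \<open>E \<noteq> F\<close> eE e0 v(1) v0] .
  note surj = surj_chart[OF inj]
  have \<phi>a: "a = ?\<phi> (- 1, 0)" and \<phi>b: "b = ?\<phi> (\<beta>, 0)"
    using bQ by (simp_all add: chart_def e_def algebra_simps)
  have ray: "ray_point Q v t = ?\<phi> (0, t)" for t
    by (simp add: ray_point_def chart_def)
  have I': "I = torus_proj ` ?\<phi> ` ({- 1..\<beta>} \<times> {0})"
    using \<beta>0 by (simp add: I \<phi>a \<phi>b chart_horizontal_segment)

  define G where "G = {w. fst w *\<^sub>R e + snd w *\<^sub>R v \<in> \<int> \<times> \<int>}"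
  have proj: "torus_proj (?\<phi> z) = torus_proj (?\<phi> z') \<longleftrightarrow> z' - z \<in> G" for z z'
    by (simp add: torus_proj_eq_iff chart_diff G_def)
  have Gneg: "- w \<in> G" if "w \<in> G" for w
    using that proj[of 0 w] proj[of w 0] by auto
  \<comment> \<open>A hit at the point of \<open>I\<close> with first coordinate x yields the
    lattice vector \<open>(- x, y)\<close>, so the strip for lattice vectors is the mirror image of
    the interval of \<open>I\<close>.\<close>
  have hits: "torus_proj (?\<phi> (0, y)) \<in> I \<longleftrightarrow> (\<exists>x. - \<beta> \<le> x \<and> x \<le> 1 \<and> (x, y) \<in> G)" for y
  proof -
    have "torus_proj (?\<phi> (0, y)) \<in> I \<longleftrightarrow> (\<exists>x\<in>{- 1..\<beta>}. torus_proj (?\<phi> (x, 0)) = torus_proj (?\<phi> (0, y)))"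
      unfolding I' by (auto simp: image_iff)
    also have "\<dots> \<longleftrightarrow> (\<exists>x\<in>{- 1..\<beta>}. (- x, y) \<in> G)" by (simp add: proj)
    also have "\<dots> \<longleftrightarrow> (\<exists>x. - \<beta> \<le> x \<and> x \<le> 1 \<and> (x, y) \<in> G)"
    proof
      assume "\<exists>x. - \<beta> \<le> x \<and> x \<le> 1 \<and> (x, y) \<in> G"
      then obtain x where "- \<beta> \<le> x" "x \<le> 1" "(x, y) \<in> G" by blast
      then show "\<exists>x\<in>{- 1..\<beta>}. (- x, y) \<in> G" by (intro bexI[of _ "- x"]) auto
    next
      assume "\<exists>x\<in>{- 1..\<beta>}. (- x, y) \<in> G"
      then obtain x where "- 1 \<le> x" "x \<le> \<beta>" "(- x, y) \<in> G" by auto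
      then show "\<exists>x. - \<beta> \<le> x \<and> x \<le> 1 \<and> (x, y) \<in> G" by (intro exI[of _ "- x"]) auto
    qed
    finally show ?thesis .
  qed
  \<comment> \<open>The hits at \<open>A\<close> and \<open>B\<close> give the generators,
    irrationality of \<open>E\<close> gives \<open>axis\<close>, and the absence of other hits
    before \<open>tB\<close> gives \<open>return\<close>.\<close>
  interpret return_lattice 1 \<beta> tA tB G
  proof
    show "w + w' \<in> G" if "w \<in> G" "w' \<in> G" for w w'
    proof -
      have "torus_proj (?\<phi> 0) = torus_proj (?\<phi> w)" "torus_proj (?\<phi> w) = torus_proj (?\<phi> (w + w'))"
        unfolding proj using that by simp_all
      then show ?thesis using proj[of 0 "w + w'"] by simp
    qed
    show "(1, tA) \<in> G" "(- \<beta>, tB) \<in> G"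
      using A B by (simp_all add: ray \<phi>a \<phi>b proj)
    show "x = 0" if "(x, 0) \<in> G" for x
      using irrational_line_integer_point[OF E irrational_line_scale[OF E eE], of x] that e0
      by (simp add: G_def)
    show "y = tA" if "(x, y) \<in> G" "- \<beta> \<le> x" "x \<le> 1" "0 < y" "y < tB" for x y
      using avoid[of y] hits[of y] that by (auto simp: ray)
  qed (use \<beta>0 tAB Gneg in auto)

  have "tB < tC" and hitC: "torus_proj (?\<phi> (0, tC)) \<in> I"
    and first: "\<And>y. tB < y \<Longrightarrow> y < tC \<Longrightarrow> torus_proj (?\<phi> (0, y)) \<notin> I"
    using hit by (simp_all add: next_hit_def ray)
  have tC: "tC = tA + tB"
  proof -
    obtain x where "(x, tC) \<in> G" "- \<beta> \<le> x" "x \<le> 1" using hitC hits by blast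
    then show ?thesis using next_return[OF \<open>tB < tC\<close>] first hits by blast
  qed
  have arc: "ray_arc Q v tC = torus_proj ` ?\<phi> ` ({0} \<times> {0..tC})"
    by (auto simp: ray_arc_def ray)
  have walls: "ray_arc Q v tC \<union> I = torus_proj ` ?\<phi> ` walls"
    unfolding arc unfolding I' walls_def image_Un tC ..

  \<comment> \<open>Index 1 is the left box and every other index the right one, so that
    \<open>markov\<close> below can be stated for all indices at once.\<close>
  define R :: "nat \<Rightarrow> plane set" where
    "R i = ?\<phi> ` (if i = 1 then {- 1..0} \<times> {0..tB} else {0..\<beta>} \<times> {0..tA})" for i
  have int: "interior (R 1) = ?\<phi> ` left_cell" "interior (R 2) = ?\<phi> ` right_cell"
    by (simp_all add: R_def interior_chart[OF inj] interior_Times left_cell_def right_cell_def)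
  have parts: "open_part (R 1) = torus_proj ` ?\<phi> ` left_cell"
    "open_part (R 2) = torus_proj ` ?\<phi> ` right_cell"
    unfolding open_part_def int by (rule refl)+
  \<comment> \<open>Injectivity on the whole tile yields injectivity on each open box as well as
    disjointness of their projections.\<close>
  have inj_tile: "inj_on torus_proj (?\<phi> ` tile)"
    by (rule inj_onI) (use tile_unique proj in blast)
  have markov: "markov_parallelogram E F (R i)" for i
    using \<beta>0 tAB markov_parallelogram_chart[OF irrational_line_scale[OF E eE] e0
        irrational_line_scale[OF F v(1)] v0]
    by (simp add: R_def)
  have "inj_on torus_proj (interior (R 1))" "inj_on torus_proj (interior (R 2))"
    unfolding int using inj_on_subset[OF inj_tile] cells_subset_tile by (meson image_mono)+
  then have tm: "torus_markov_parallelogram E F (R 1)" "torus_markov_parallelogram E F (R 2)"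
    using markov unfolding torus_markov_parallelogram_def by blast+
  have disj: "open_part (R 1) \<inter> open_part (R 2) = {}"
  proof -
    have "?\<phi> ` left_cell \<inter> ?\<phi> ` right_cell = {}"
      using cells_disjoint inj by (simp add: image_Int[symmetric])
    then show ?thesis
      unfolding parts using inj_on_image_Int[OF inj_tile] cells_subset_tile
      by (metis image_empty image_mono)
  qed
  have compl: "torus - (ray_arc Q v tC \<union> I) = open_part (R 1) \<union> open_part (R 2)"
  proof -
    have "open_part (R 1) \<union> open_part (R 2) = torus_proj ` ?\<phi> ` (left_cell \<union> right_cell)"
      unfolding parts image_Un ..
    \<comment> \<open>Walls and cells together meet every class, and no class meets both; hence the
      projected cells are exactly the complement of the projected walls.\<close>
    moreover have "torus = torus_proj ` ?\<phi> ` walls \<union> torus_proj ` ?\<phi> ` (left_cell \<union> right_cell)"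
    proof -
      have "torus_proj (?\<phi> z) \<in> torus_proj ` ?\<phi> ` (walls \<union> (left_cell \<union> right_cell))" for z
      proof -
        obtain w where w: "w \<in> G" "z + w \<in> walls \<union> (left_cell \<union> right_cell)"
          using cell_or_wall by blast
        then have "torus_proj (?\<phi> z) = torus_proj (?\<phi> (z + w))" by (simp add: proj)
        then show ?thesis using w by blast
      qed
      then have "torus_proj ` ?\<phi> ` UNIV \<subseteq> torus_proj ` ?\<phi> ` (walls \<union> (left_cell \<union> right_cell))"
        by (intro image_subsetI) auto
      moreover have "torus = torus_proj ` ?\<phi> ` UNIV" by (simp add: torus_eq_range surj)
      ultimately show ?thesis
        unfolding image_Un[symmetric] by (metis image_mono subset_UNIV subset_antisym)
    qed
    moreover have "torus_proj ` ?\<phi> ` walls \<inter> torus_proj ` ?\<phi> ` (left_cell \<union> right_cell) = {}"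
    proof (rule equals0I, elim IntE imageE)
      fix X y y' z z'
      assume "X = torus_proj y" "X = torus_proj y'" "y = ?\<phi> z" "y' = ?\<phi> z'"
        and "z \<in> walls" "z' \<in> left_cell \<union> right_cell"
      then show False using wall_not_cell[of z z'] proj[of z z'] by metis
    qed
    moreover have "X \<union> Y - X = Y" if "X \<inter> Y = {}" for X Y :: "plane set set"
      using that by blast
    ultimately show ?thesis unfolding walls by metis
  qed
  have leafI: "leaf_arc E I"
    unfolding leaf_arc_def
  proof (intro exI conjI)
    show "a \<noteq> b" using Q by auto
    have "b - a = (\<beta> + 1) *\<^sub>R e" using bQ by (simp add: e_def algebra_simps)
    then show "b - a \<in> E" using irrational_line_scale[OF E eE] by simp
  qed (fact I)
  have leaf_arc: "leaf_arc F (ray_arc Q v tC)"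
    unfolding leaf_arc_def
  proof (intro exI conjI)
    show "?\<phi> (0, 0) \<noteq> ?\<phi> (0, tC)" using tAB tC v0 by (simp add: chart_def)
    show "?\<phi> (0, tC) - ?\<phi> (0, 0) \<in> F"
      using irrational_line_scale[OF F v(1)] by (simp add: chart_def)
    show "ray_arc Q v tC = torus_proj ` closed_segment (?\<phi> (0, 0)) (?\<phi> (0, tC))"
      unfolding arc using tAB tC by (simp add: chart_vertical_segment)
  qed
  have boundary: "torus - (open_part (R 1) \<union> open_part (R 2)) = ray_arc Q v tC \<union> I"
  proof -
    have "ray_arc Q v tC \<union> I \<subseteq> torus" unfolding walls torus_eq_range by blast
    then show ?thesis unfolding compl[symmetric] by blast
  qed
  have two: "{1..2::nat} = {1, 2}" by auto
  have "quasi_Markov_partition E F 2 R"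
    unfolding quasi_Markov_partition_def two
  \<comment> \<open>The finite family of boundary arcs consists of just the ray arc and
    \<open>I\<close>.\<close>
  proof (intro conjI exI[of _ "{ray_arc Q v tC, I}"])
    show "torus - (\<Union>i\<in>{1, 2}. open_part (R i)) = \<Union>{ray_arc Q v tC, I}"
      using boundary by blast
  qed (use tm disj leafI leaf_arc in blast)+
  then show ?thesis using compl disj by blast
qed

theorem mainTheorem2:
  fixes E1 E2 :: "plane set" and Q v :: plane and I :: "plane set set"
    and A B :: "plane set" and tA tB tC :: real
  assumes "irrational_line E1" and "irrational_line E2" and "E1 \<noteq> E2"
    and "T_configuration E1 E2 Q v I A B tA tB"
    and "next_hit Q v I tB tC"
  shows "\<exists>R. quasi_Markov_partition E1 E2 2 R \<and>
           torus - (ray_arc Q v tC \<union> I) = open_part (R 1) \<union> open_part (R 2) \<and>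
           open_part (R 1) \<inter> open_part (R 2) = {}"
proof -
  obtain E F a b where EF: "E = E1 \<and> F = E2 \<or> E = E2 \<and> F = E1"
    and T: "v \<in> F" "norm v = 1" "a - Q \<in> E" "Q \<in> open_segment a b"
      "I = torus_proj ` closed_segment a b" "0 < tA" "tA < tB"
      "torus_proj a = torus_proj (ray_point Q v tA)" "torus_proj b = torus_proj (ray_point Q v tB)"
      "\<And>t. 0 < t \<Longrightarrow> t < tB \<Longrightarrow> t \<noteq> tA \<Longrightarrow> torus_proj (ray_point Q v t) \<notin> I"
    using assms(4) unfolding T_configuration_def by metis
  have "irrational_line E" "irrational_line F" "E \<noteq> F" using EF assms by auto
  \<comment> \<open>If \<open>I\<close> runs along \<open>E2\<close>, the partition is obtained for
    the directions in reverse order, and the swap lemma restores the order.\<close>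
  from T_configuration_partition[OF this T assms(5)] EF show ?thesis
    using quasi_Markov_partition_swap[of E1 E2] by auto
qed

end
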